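(* For any integer $k\ge 2$ and any fixed graph $G$ with $\chi(G)\ge k+1$, $$\hat{\pi}_k(G)=1-\frac{1}{\chi(G)-1}.$$
   Context: A $k$-graph is a hypergraph all of whose edges have exactly $k$ vertices. The shadow $\partial(\mathcal{H})$ of a hypergraph $\mathcal{H}$ is the simple graph on $V(\mathcal{H})$ in which $uv$ is an edge iff $\{u,v\}\subseteq h$ for some edge $h$ of $\mathcal{H}$. For a simple graph $G$, a hypergraph $\mathcal{H}$ is a Berge-$G$ if there is an injection $i:V(G)\to V(\mathcal{H})$ and a bijection $f:E(G)\to E(\mathcal{H})$ with $\{i(u),i(v)\}\subseteq f(uv)$ for every $uv\in E(G)$; $\mathcal{H}$ is Berge-$G$-free if no subhypergraph of it is a Berge-$G$. $\hat{\mathrm{ex}}_k(n,G)$ is the maximum number of edges of $\partial(\mathcal{H})$ over all Berge-$G$-free $k$-graphs $\mathcal{H}$ on $n$ vertices, and the cover Turán density is $\hat{\pi}_k(G)=\limsup_{n\to\infty}\hat{\mathrm{ex}}_k(n,G)/\binom{n}{2}$. $\chi(G)$ is the chromatic number. *)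

theory Defs
  imports "HOL-Analysis.Analysis"
begin

type_synonym 'a hgraph = "'a set \<times> 'a set set"

abbreviation verts :: "'a hgraph \<Rightarrow> 'a set" where
  "verts H \<equiv> fst H"

abbreviation edges :: "'a hgraph \<Rightarrow> 'a set set" where
  "edges H \<equiv> snd H"

definition hypergraph :: "'a hgraph \<Rightarrow> bool" where
  "hypergraph H \<longleftrightarrow> finite (verts H) \<and> (\<forall>h\<in>edges H. h \<subseteq> verts H)"

definition k_graph :: "nat \<Rightarrow> 'a hgraph \<Rightarrow> bool" where
  "k_graph k H \<longleftrightarrow> hypergraph H \<and> (\<forall>h\<in>edges H. card h = k)"

abbreviation simple_graph :: "'a hgraph \<Rightarrow> bool" where
  "simple_graph G \<equiv> k_graph 2 G"

definition shadow :: "'a hgraph \<Rightarrow> 'a hgraph" where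
  "shadow H = (verts H, {{u, v} | u v. u \<noteq> v \<and> (\<exists>h\<in>edges H. {u, v} \<subseteq> h)})"

definition subhypergraph :: "'a hgraph \<Rightarrow> 'a hgraph \<Rightarrow> bool" where
  "subhypergraph H' H \<longleftrightarrow>
     hypergraph H' \<and> verts H' \<subseteq> verts H \<and> edges H' \<subseteq> edges H"

definition is_Berge :: "'a hgraph \<Rightarrow> 'b hgraph \<Rightarrow> bool" where
  "is_Berge G H \<longleftrightarrow>
     (\<exists>i f. inj_on i (verts G) \<and> i ` verts G \<subseteq> verts H \<and>
            bij_betw f (edges G) (edges H) \<and>
            (\<forall>u v. {u, v} \<in> edges G \<longrightarrow> {i u, i v} \<subseteq> f {u, v}))"

definition Berge_free :: "'a hgraph \<Rightarrow> 'b hgraph \<Rightarrow> bool" where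
  "Berge_free G H \<longleftrightarrow> \<not> (\<exists>H'. subhypergraph H' H \<and> is_Berge G H')"

text \<open>Every finite hypergraph is isomorphic to one whose vertices are natural numbers,
  so the maximum is taken over hypergraphs on vertex type \<^typ>\<open>nat\<close>.  The set below is
  always finite; it is nonempty whenever \<open>G\<close> has an edge.\<close>

definition cover_ex :: "nat \<Rightarrow> nat \<Rightarrow> 'a hgraph \<Rightarrow> nat" where
  "cover_ex k n G =
     Max {card (edges (shadow H)) | H :: nat hgraph.
            k_graph k H \<and> card (verts H) = n \<and> Berge_free G H}"

text \<open>The limit superior is taken in \<^typ>\<open>ereal\<close>, since the real numbers are not a
  complete lattice.\<close>

definition cover_turan_density :: "nat \<Rightarrow> 'a hgraph \<Rightarrow> ereal" where
  "cover_turan_density k G =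
     limsup (\<lambda>n. ereal (real (cover_ex k n G) / real (n choose 2)))"

definition proper_coloring :: "'a hgraph \<Rightarrow> nat \<Rightarrow> ('a \<Rightarrow> nat) \<Rightarrow> bool" where
  "proper_coloring G c col \<longleftrightarrow>
     col ` verts G \<subseteq> {..<c} \<and> (\<forall>u v. {u, v} \<in> edges G \<longrightarrow> col u \<noteq> col v)"

definition chromatic_number :: "'a hgraph \<Rightarrow> nat" where
  "chromatic_number G = (LEAST c. \<exists>col. proper_coloring G c col)"

end

theory Submission
  imports Defs
begin

text \<open>
  Let \<open>r = \<chi>(G) - 1\<close>. For the lower bound, split the vertices into \<open>r\<close> balanced classes and take all
  \<open>k\<close>-sets meeting each class at most once. As \<open>r \<ge> k\<close>, the shadow is complete \<open>r\<close>-partite, and a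
  Berge copy of \<open>G\<close> would give an \<open>r\<close>-colouring of \<open>G\<close>.

  For the upper bound, let the shadow of a Berge-\<open>G\<close>-free hypergraph on \<open>n\<close> vertices have edge
  density \<open>1 - \<gamma> > 1 - 1/r\<close>. By Moon and Moser, the numbers \<open>h\<^sub>t\<close> of homomorphisms from the complete
  graph on \<open>t\<close> vertices into the shadow satisfy \<open>h\<^sub>t\<^sub>+\<^sub>1 \<ge> (1 - t\<gamma>) n h\<^sub>t\<close>, so the complete graph on
  \<open>r + 1\<close> vertices has homomorphism density at least \<open>(1 - r\<gamma>)\<^sup>r\<^sup>+\<^sup>1\<close>. Duplicating a vertex at worst
  squares the homomorphism density, by Cauchy-Schwarz; hence at least \<open>\<delta> n\<^sup>m\<close> maps \<open>V(G) \<rightarrow> V(H)\<close>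
  are homomorphisms, where \<open>m = |V(G)|\<close> and \<open>\<delta> > 0\<close> does not depend on \<open>n\<close>. Fix a hyperedge covering
  each shadow edge. Only \<open>O(n\<^sup>m\<^sup>-\<^sup>1)\<close> maps are non-injective or send a vertex into the hyperedge
  assigned to an edge not containing it, and any other homomorphism yields a Berge copy of \<open>G\<close>.
  So \<open>n\<close> is bounded.
\<close>

section \<open>Counting homomorphisms\<close>

definition homs ::
  "('v \<Rightarrow> 'v \<Rightarrow> bool) \<Rightarrow> 'v set \<Rightarrow> ('b \<Rightarrow> 'b \<Rightarrow> bool) \<Rightarrow> 'b set \<Rightarrow> ('v \<Rightarrow> 'b) set" where
  "homs B V A X = {\<phi> \<in> V \<rightarrow>\<^sub>E X. \<forall>u\<in>V. \<forall>v\<in>V. B u v \<longrightarrow> A (\<phi> u) (\<phi> v)}"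

definition common_nbrs :: "('b \<Rightarrow> 'b \<Rightarrow> bool) \<Rightarrow> 'b set \<Rightarrow> 'b set \<Rightarrow> 'b set" where
  "common_nbrs A X Y = {x \<in> X. \<forall>y\<in>Y. A y x}"

lemma finite_common_nbrs [simp]: "finite X \<Longrightarrow> finite (common_nbrs A X Y)"
  by (simp add: common_nbrs_def)

lemma finite_homs [simp]: "finite V \<Longrightarrow> finite X \<Longrightarrow> finite (homs B V A X)"
  by (simp add: homs_def finite_PiE)

lemma homs_empty [simp]: "homs B {} A X = {\<lambda>_. undefined}"
  by (auto simp: homs_def)

lemma card_homs_le:
  assumes "finite V" "finite X"
  shows "card (homs B V A X) \<le> card X ^ card V"
proof -
  have "card (homs B V A X) \<le> card (V \<rightarrow>\<^sub>E X)"
    using assms by (intro card_mono) (auto simp: homs_def finite_PiE)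
  then show ?thesis
    using assms by (simp add: card_PiE)
qed

lemma homs_insert:
  assumes "symp A" "symp B" "\<not> B b b" "b \<notin> V"
  shows "bij_betw (\<lambda>(\<psi>, x). \<psi>(b := x))
    (SIGMA \<psi> : homs B V A X. common_nbrs A X (\<psi> ` {u \<in> V. B u b}))
    (homs B (insert b V) A X)"
proof (rule bij_betw_byWitness[where f' = "\<lambda>\<phi>. (restrict \<phi> V, \<phi> b)"])
  let ?extend = "\<lambda>(\<psi>, x). \<psi>(b := x)"
  let ?D = "SIGMA \<psi> : homs B V A X. common_nbrs A X (\<psi> ` {u \<in> V. B u b})"
  show "\<forall>p\<in>?D. (restrict (?extend p) V, ?extend p b) = p"
    using \<open>b \<notin> V\<close> by (auto simp: homs_def fun_eq_iff PiE_def extensional_def)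
  show "\<forall>\<phi>\<in>homs B (insert b V) A X. ?extend (restrict \<phi> V, \<phi> b) = \<phi>"
    by (auto simp: homs_def fun_eq_iff PiE_def extensional_def)
  show "?extend ` ?D \<subseteq> homs B (insert b V) A X"
  proof clarify
    fix \<psi> x
    assume \<psi>: "\<psi> \<in> homs B V A X" and x: "x \<in> common_nbrs A X (\<psi> ` {u \<in> V. B u b})"
    have "\<psi>(b := x) \<in> insert b V \<rightarrow>\<^sub>E X"
      using \<psi> x by (intro PiE_fun_upd) (auto simp: homs_def common_nbrs_def)
    then show "\<psi>(b := x) \<in> homs B (insert b V) A X"
      using \<psi> x assms by (auto simp: homs_def common_nbrs_def dest: sympD)
  qed
  show "(\<lambda>\<phi>. (restrict \<phi> V, \<phi> b)) ` homs B (insert b V) A X \<subseteq> ?D"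
    by (auto simp: homs_def common_nbrs_def)
qed

lemma sum_homs_insert:
  fixes f :: "('v \<Rightarrow> 'b) \<Rightarrow> 'c :: comm_monoid_add"
  assumes "symp A" "symp B" "\<not> B b b" "b \<notin> V" "finite V" "finite X"
  shows "(\<Sum>\<phi>\<in>homs B (insert b V) A X. f \<phi>)
    = (\<Sum>\<psi>\<in>homs B V A X. \<Sum>x\<in>common_nbrs A X (\<psi> ` {u \<in> V. B u b}). f (\<psi>(b := x)))"
  using sum.reindex_bij_betw[OF homs_insert[OF assms(1-4)], of f X] assms(5,6)
  by (subst sum.Sigma) (auto simp: case_prod_unfold)

lemma card_homs_insert:
  assumes "symp A" "symp B" "\<not> B b b" "b \<notin> V" "finite V" "finite X"
  shows "card (homs B (insert b V) A X)
    = (\<Sum>\<psi>\<in>homs B V A X. card (common_nbrs A X (\<psi> ` {u \<in> V. B u b})))"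
  using sum_homs_insert[OF assms, of "\<lambda>_. 1 :: nat"] by simp

lemma square_card_homs_le:
  assumes "symp A" "symp B" "\<not> B a a" "a \<in> V" "finite V" "finite X"
  shows "(card (homs B V A X))\<^sup>2
    \<le> card (homs B (V - {a}) A X)
      * (\<Sum>\<phi>\<in>homs B V A X. card (common_nbrs A X (\<phi> ` {u \<in> V. B u a})))"
proof -
  define W where "W = V - {a}"
  define P where "P = homs B W A X"
  define ext where "ext \<psi> = common_nbrs A X (\<psi> ` {u \<in> W. B u a})" for \<psi>
  have V: "V = insert a W" "a \<notin> W" "finite W"
    using assms by (auto simp: W_def)
  have ext_V: "common_nbrs A X (\<psi>(a := x) ` {u \<in> V. B u a}) = ext \<psi>" for \<psi> x
    using V \<open>\<not> B a a\<close> by (auto simp: ext_def common_nbrs_def)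
  have homs_V: "card (homs B V A X) = (\<Sum>\<psi>\<in>P. card (ext \<psi>))"
    unfolding P_def ext_def V(1) using assms V by (intro card_homs_insert) auto
  have sum_V: "(\<Sum>\<phi>\<in>homs B V A X. card (common_nbrs A X (\<phi> ` {u \<in> V. B u a})))
      = (\<Sum>\<psi>\<in>P. \<Sum>x\<in>ext \<psi>. card (common_nbrs A X (\<psi>(a := x) ` {u \<in> V. B u a})))"
    unfolding P_def ext_def V(1) using assms V by (intro sum_homs_insert) auto
  have "real ((\<Sum>\<psi>\<in>P. card (ext \<psi>))\<^sup>2) \<le> real (card P * (\<Sum>\<psi>\<in>P. (card (ext \<psi>))\<^sup>2))"
    using sum_squared_le_sum_of_squares[of "\<lambda>\<psi>. real (card (ext \<psi>))" P] by (simp add: mult.commute)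
  then show ?thesis
    unfolding homs_V sum_V ext_V P_def[symmetric] W_def[symmetric] of_nat_le_iff
    by (simp add: power2_eq_square)
qed

section \<open>Homomorphism densities\<close>

definition hom_density ::
  "('v \<Rightarrow> 'v \<Rightarrow> bool) \<Rightarrow> 'v set \<Rightarrow> ('b \<Rightarrow> 'b \<Rightarrow> bool) \<Rightarrow> 'b set \<Rightarrow> real" where
  "hom_density B V A X = real (card (homs B V A X)) / real (card X) ^ card V"

definition edge_density :: "('b \<Rightarrow> 'b \<Rightarrow> bool) \<Rightarrow> 'b set \<Rightarrow> real" where
  "edge_density A X = real (card {(x, y) \<in> X \<times> X. A x y}) / (real (card X))\<^sup>2"

lemma edge_density_le_1:
  assumes "finite X"
  shows "edge_density A X \<le> 1"
proof -
  have "card {(x, y) \<in> X \<times> X. A x y} \<le> card (X \<times> X)"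
    using assms by (intro card_mono) auto
  then have "real (card {(x, y) \<in> X \<times> X. A x y}) \<le> real (card (X \<times> X))"
    by (simp only: of_nat_le_iff)
  then show ?thesis
    by (cases "card X = 0") (auto simp: edge_density_def card_cartesian_product power2_eq_square)
qed

lemma hom_density_nonneg: "0 \<le> hom_density B V A X"
  by (simp add: hom_density_def)

lemma hom_density_antimono:
  assumes "finite V" "finite X" "\<And>u v. u \<in> V \<Longrightarrow> v \<in> V \<Longrightarrow> B u v \<Longrightarrow> B' u v"
  shows "hom_density B' V A X \<le> hom_density B V A X"
proof -
  have "homs B' V A X \<subseteq> homs B V A X"
    using assms(3) by (auto simp: homs_def)
  then show ?thesis
    using assms(1,2) by (simp add: hom_density_def divide_right_mono card_mono)
qed

lemma hom_density_twin:
  assumes "symp A" "symp B" "irreflp B" "finite V" "finite X" "a \<in> V" "b \<notin> V"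
    and twin: "\<And>u. u \<in> V \<Longrightarrow> B u b \<longleftrightarrow> B u a"
  shows "(hom_density B V A X)\<^sup>2 \<le> hom_density B (insert b V) A X"
proof -
  obtain m where m: "card V = Suc m" "card (V - {a}) = m"
    using assms by (metis card_Suc_Diff1)
  have irr: "\<not> B c c" for c
    using \<open>irreflp B\<close> by (rule irreflpD)
  have "{u \<in> V. B u b} = {u \<in> V. B u a}"
    using twin by auto
  then have "(card (homs B V A X))\<^sup>2
      \<le> card (homs B (V - {a}) A X) * card (homs B (insert b V) A X)"
    using square_card_homs_le[of A B a V X] card_homs_insert[of A B b V X] assms irr by simp
  also have "\<dots> \<le> card X ^ m * card (homs B (insert b V) A X)"
    using card_homs_le[of "V - {a}" X B A] assms m by (intro mult_right_mono) auto
  finally have "real ((card (homs B V A X))\<^sup>2)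
      \<le> real (card X ^ m * card (homs B (insert b V) A X))"
    by (simp only: of_nat_le_iff)
  then have "(hom_density B V A X)\<^sup>2
      \<le> real (card X) ^ m * real (card (homs B (insert b V) A X)) / (real (card X) ^ Suc m)\<^sup>2"
    using m(1) by (simp add: hom_density_def power_divide divide_right_mono)
  also have "\<dots> = hom_density B (insert b V) A X"
    using m(1) assms by (simp add: hom_density_def power2_eq_square)
  finally show ?thesis .
qed

lemma hom_density_blowup:
  assumes "symp A" "symp B" "irreflp B" "finite T" "finite X" "finite U" "U \<inter> T = {}"
    and twin: "\<And>b. b \<in> U \<Longrightarrow> \<exists>a\<in>T. \<forall>u. B u b \<longleftrightarrow> B u a"
  shows "hom_density B T A X ^ (2 ^ card U) \<le> hom_density B (U \<union> T) A X"
  using \<open>finite U\<close> \<open>U \<inter> T = {}\<close> twin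
proof (induction U rule: finite_induct)
  case (insert b U)
  obtain a where a: "a \<in> T" "\<forall>u. B u b \<longleftrightarrow> B u a"
    using insert.prems by blast
  have "hom_density B T A X ^ (2 ^ card (insert b U)) = (hom_density B T A X ^ (2 ^ card U))\<^sup>2"
    using insert.hyps by (simp add: power_mult[symmetric] mult.commute)
  also have "\<dots> \<le> (hom_density B (U \<union> T) A X)\<^sup>2"
    using insert by (intro power_mono) (auto simp: hom_density_nonneg)
  also have "\<dots> \<le> hom_density B (insert b (U \<union> T)) A X"
    using assms insert a by (intro hom_density_twin) auto
  finally show ?case by simp
qed simp

section \<open>Moon and Moser's inequality\<close>

lemma sum_card_common_nbrs_remove_le:
  assumes "finite T" "T \<noteq> {}" "finite X"
  shows "(\<Sum>a\<in>T. card (common_nbrs A X (f ` (T - {a}))))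
    \<le> card X + (card T - 1) * card (common_nbrs A X (f ` T))"
proof -
  define C where "C = common_nbrs A X (f ` T)"
  define D where "D a = common_nbrs A X (f ` (T - {a})) - C" for a
  have C: "finite C" "C \<subseteq> X"
    using \<open>finite X\<close> by (auto simp: C_def common_nbrs_def)
  have D: "finite (D a)" "D a \<subseteq> X - C" for a
    using \<open>finite X\<close> by (auto simp: D_def common_nbrs_def)
  \<comment> \<open>A vertex adjacent to all of \<open>f ` (T - {a})\<close> and all of \<open>f ` (T - {b})\<close> with \<open>a \<noteq> b\<close> is adjacent
    to all of \<open>f ` T\<close>.\<close>
  have "disjoint_family_on D T"
    by (fastforce simp: disjoint_family_on_def D_def C_def common_nbrs_def)
  then have "(\<Sum>a\<in>T. card (D a)) = card (\<Union>a\<in>T. D a)"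
    using \<open>finite T\<close> D by (intro card_UN_disjoint'[symmetric]) auto
  also have "\<dots> \<le> card (X - C)"
    using \<open>finite X\<close> D by (intro card_mono) auto
  finally have sum_D: "(\<Sum>a\<in>T. card (D a)) + card C \<le> card X"
    using C \<open>finite X\<close> card_mono[OF \<open>finite X\<close> C(2)] by (simp add: card_Diff_subset)
  have "card (common_nbrs A X (f ` (T - {a}))) = card C + card (D a)" if "a \<in> T" for a
  proof -
    have "C \<subseteq> common_nbrs A X (f ` (T - {a}))"
      by (auto simp: C_def common_nbrs_def)
    then show ?thesis
      using \<open>finite X\<close> C by (simp add: D_def card_Diff_subset card_mono)
  qed
  then have "(\<Sum>a\<in>T. card (common_nbrs A X (f ` (T - {a})))) = card T * card C + (\<Sum>a\<in>T. card (D a))"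
    by (simp add: sum.distrib)
  also have "\<dots> = (card T - 1) * card C + (card C + (\<Sum>a\<in>T. card (D a)))"
    using assms by (cases "card T") auto
  finally show ?thesis
    using sum_D by (simp add: C_def)
qed

lemma sum_complete_homs_twins_le:
  assumes "symp A" "finite T" "T \<noteq> {}" "finite X" "b \<notin> T"
  shows "(\<Sum>a\<in>T. \<Sum>\<phi>\<in>homs (\<noteq>) T A X. card (common_nbrs A X (\<phi> ` (T - {a}))))
    \<le> card X * card (homs (\<noteq>) T A X) + (card T - 1) * card (homs (\<noteq>) (insert b T) A X)"
proof -
  have "{u \<in> T. u \<noteq> b} = T"
    using \<open>b \<notin> T\<close> by auto
  then have homs_b: "card (homs (\<noteq>) (insert b T) A X)
      = (\<Sum>\<phi>\<in>homs (\<noteq>) T A X. card (common_nbrs A X (\<phi> ` T)))"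
    using card_homs_insert[of A "(\<noteq>)" b T X] assms by (simp add: symp_def)
  have "(\<Sum>\<phi>\<in>homs (\<noteq>) T A X. \<Sum>a\<in>T. card (common_nbrs A X (\<phi> ` (T - {a}))))
      \<le> (\<Sum>\<phi>\<in>homs (\<noteq>) T A X. card X + (card T - 1) * card (common_nbrs A X (\<phi> ` T)))"
    using assms by (intro sum_mono sum_card_common_nbrs_remove_le)
  then show ?thesis
    by (subst sum.swap) (simp add: homs_b sum.distrib mult.commute flip: sum_distrib_left)
qed

lemma card_complete_homs_singleton:
  assumes "symp A" "finite X"
  shows "card (homs (\<noteq>) {b} A X) = card X"
  using card_homs_insert[of A "(\<noteq>)" b "{}" X] assms by (simp add: symp_def common_nbrs_def)

lemma card_complete_homs_pair:
  assumes "symp A" "finite X" "a \<noteq> b"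
  shows "real (card (homs (\<noteq>) {a, b} A X)) = edge_density A X * (real (card X))\<^sup>2"
proof -
  have "card (homs (\<noteq>) {a, b} A X)
      = (\<Sum>\<psi>\<in>homs (\<noteq>) {b} A X. card (common_nbrs A X (\<psi> ` {b})))"
    using card_homs_insert[of A "(\<noteq>)" a "{b}" X] assms by (simp add: symp_def Collect_conv_if)
  also have "\<dots> = (\<Sum>x\<in>X. card {y \<in> X. A x y})"
    using sum_homs_insert[of A "(\<noteq>)" b "{}" X "\<lambda>\<psi>. card (common_nbrs A X (\<psi> ` {b}))"] assms
    by (simp add: symp_def common_nbrs_def)
  also have "\<dots> = card (SIGMA x : X. {y \<in> X. A x y})"
    using \<open>finite X\<close> by (simp add: card_SigmaI)
  also have "(SIGMA x : X. {y \<in> X. A x y}) = {(x, y) \<in> X \<times> X. A x y}"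
    by auto
  finally show ?thesis
    using \<open>finite X\<close> by (cases "X = {}") (simp_all add: edge_density_def)
qed

lemma mult_le_if_power2_le_mult:
  fixes x y z \<rho> :: real
  assumes "\<rho> * y \<le> x" "x\<^sup>2 \<le> y * z" "0 \<le> x" "0 \<le> y" "0 \<le> z"
  shows "\<rho> * x \<le> z"
proof (cases "y = 0")
  case True
  then show ?thesis
    using assms by simp
next
  case False
  have "y * (\<rho> * x) \<le> x * x"
    using mult_right_mono[OF assms(1,3)] by (simp add: algebra_simps)
  also have "\<dots> \<le> y * z"
    using assms(2) by (simp add: power2_eq_square)
  finally show ?thesis
    using False assms(4) by simp
qed

lemma card_complete_homs_insert_step:
  fixes \<rho> :: real and T :: "'v set"
  assumes "symp A" "finite X" "finite T" "T \<noteq> {}" "b \<notin> T"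
    and remove: "\<And>a. a \<in> T \<Longrightarrow>
      \<rho> * real (card (homs (\<noteq>) (T - {a}) A X)) \<le> real (card (homs (\<noteq>) T A X))"
  shows "(real (card T) * \<rho> - real (card X)) * real (card (homs (\<noteq>) T A X))
    \<le> real (card T - 1) * real (card (homs (\<noteq>) (insert b T) A X))"
proof -
  define h where "h T = card (homs (\<noteq>) T A X)" for T :: "'v set"
  define twins where "twins a = (\<Sum>\<phi>\<in>homs (\<noteq>) T A X. card (common_nbrs A X (\<phi> ` (T - {a}))))" for a
  have "\<rho> * real (h T) \<le> real (twins a)" if "a \<in> T" for a
  proof (rule mult_le_if_power2_le_mult)
    show "\<rho> * real (h (T - {a})) \<le> real (h T)"
      using remove[OF that] by (simp add: h_def)
    have "{u \<in> T. u \<noteq> a} = T - {a}"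
      by auto
    then have "(h T)\<^sup>2 \<le> h (T - {a}) * twins a"
      using square_card_homs_le[of A "(\<noteq>)" a T X] assms that
      by (simp add: symp_def h_def twins_def)
    then show "(real (h T))\<^sup>2 \<le> real (h (T - {a})) * real (twins a)"
      by (simp only: of_nat_le_iff flip: of_nat_power of_nat_mult)
  qed auto
  then have "(\<Sum>a\<in>T. \<rho> * real (h T)) \<le> (\<Sum>a\<in>T. real (twins a))"
    by (rule sum_mono)
  also have "\<dots> \<le> real (card X * h T + (card T - 1) * h (insert b T))"
    using sum_complete_homs_twins_le[of A T X b] assms
    unfolding h_def twins_def of_nat_sum[symmetric] of_nat_le_iff by blast
  finally show ?thesis
    by (simp add: h_def left_diff_distrib mult.assoc)
qed

lemma card_complete_homs_insert_ge:
  fixes \<gamma> :: real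
  assumes "symp A" "finite X" "finite T" "b \<notin> T" and dense: "1 - \<gamma> \<le> edge_density A X"
  shows "(1 - real (card T) * \<gamma>) * real (card X) * real (card (homs (\<noteq>) T A X))
    \<le> real (card (homs (\<noteq>) (insert b T) A X))"
  using assms(3,4)
proof (induction "card T" arbitrary: T b)
  case 0
  then show ?case
    using card_complete_homs_singleton[of A X b] assms(1,2) by simp
next
  case (Suc s)
  define \<rho> where "\<rho> = (1 - real s * \<gamma>) * real (card X)"
  show ?case
  proof (cases "s = 0")
    case True
    then obtain a where "T = {a}"
      using Suc.hyps(2) by (metis One_nat_def card_1_singletonE)
    then show ?thesis
      using mult_right_mono[OF dense, of "(real (card X))\<^sup>2"] assms(1,2) Suc.prems
        card_complete_homs_singleton[of A X a] card_complete_homs_pair[of A X b a]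
      by (simp add: power2_eq_square mult.assoc)
  next
    case False
    have "\<rho> * real (card (homs (\<noteq>) (T - {a}) A X)) \<le> real (card (homs (\<noteq>) T A X))"
      if "a \<in> T" for a
    proof -
      have "s = card (T - {a})" "insert a (T - {a}) = T"
        using Suc.hyps(2) that by auto
      then show ?thesis
        using Suc.hyps(1)[of "T - {a}" a] Suc.prems(1) by (simp add: \<rho>_def)
    qed
    then have "(real (Suc s) * \<rho> - real (card X)) * real (card (homs (\<noteq>) T A X))
        \<le> real s * real (card (homs (\<noteq>) (insert b T) A X))"
      using card_complete_homs_insert_step[of A X T b \<rho>] assms(1,2) Suc.prems
      by (metis Suc.hyps(2) card.empty diff_Suc_1 nat.distinct(1))
    moreover have "real (Suc s) * \<rho> - real (card X)
        = real s * ((1 - real (card T) * \<gamma>) * real (card X))"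
      by (simp add: \<rho>_def algebra_simps flip: Suc.hyps(2))
    ultimately show ?thesis
      using False by (simp add: mult.assoc)
  qed
qed

lemma hom_density_complete_ge:
  fixes \<gamma> :: real
  assumes "symp A" "finite X" "X \<noteq> {}" "1 - \<gamma> \<le> edge_density A X" "real r * \<gamma> \<le> 1"
    and "finite T" "card T \<le> Suc r"
  shows "(1 - real r * \<gamma>) ^ card T \<le> hom_density (\<noteq>) T A X"
  using assms(6,7)
proof (induction T rule: finite_induct)
  case empty
  show ?case by (simp add: hom_density_def)
next
  case (insert b T)
  define n where "n = real (card X)"
  have "n > 0"
    using assms by (simp add: n_def card_gt_0_iff)
  have "1 - \<gamma> \<le> 1"
    using assms(4) edge_density_le_1[OF assms(2)] by (rule order_trans)
  then have "real (card T) * \<gamma> \<le> real r * \<gamma>"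
    using insert by (intro mult_right_mono) auto
  then have "(1 - real r * \<gamma>) ^ card (insert b T)
      \<le> (1 - real (card T) * \<gamma>) * hom_density (\<noteq>) T A X"
    using insert assms(5) by (auto intro!: mult_mono)
  also have "\<dots> = (1 - real (card T) * \<gamma>) * n * real (card (homs (\<noteq>) T A X)) / n ^ Suc (card T)"
    using \<open>n > 0\<close> by (simp add: hom_density_def n_def)
  also have "\<dots> \<le> real (card (homs (\<noteq>) (insert b T) A X)) / n ^ Suc (card T)"
    unfolding n_def
    using assms insert by (intro divide_right_mono card_complete_homs_insert_ge) auto
  also have "\<dots> = hom_density (\<noteq>) (insert b T) A X"
    using insert by (simp add: hom_density_def n_def)
  finally show ?case .
qed

lemma hom_density_multipartite_ge:
  fixes \<gamma> :: real
  assumes "symp A" "finite X" "X \<noteq> {}" "1 - \<gamma> \<le> edge_density A X" "real r * \<gamma> \<le> 1"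
    and "finite V" "card (col ` V) \<le> Suc r"
  shows "(1 - real r * \<gamma>) ^ (card V * 2 ^ card V) \<le> hom_density (\<lambda>u v. col u \<noteq> col v) V A X"
proof -
  obtain T where T: "T \<subseteq> V" "inj_on col T" "col ` V = col ` T"
    using subset_image_inj[of "col ` V" col V] by auto
  have "finite T"
    using T(1) \<open>finite V\<close> by (rule finite_subset)
  have "1 - \<gamma> \<le> 1"
    using assms(4) edge_density_le_1[OF assms(2)] by (rule order_trans)
  then have "0 \<le> real r * \<gamma>"
    by simp
  moreover have "card T * 2 ^ card (V - T) \<le> card V * 2 ^ card V"
    using T(1) \<open>finite V\<close> by (intro mult_le_mono power_increasing card_mono) auto
  ultimately have "(1 - real r * \<gamma>) ^ (card V * 2 ^ card V)
      \<le> ((1 - real r * \<gamma>) ^ card T) ^ (2 ^ card (V - T))"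
    using assms(5) by (simp add: power_decreasing flip: power_mult)
  also have "\<dots> \<le> hom_density (\<noteq>) T A X ^ (2 ^ card (V - T))"
    using assms T \<open>finite T\<close> by (intro power_mono hom_density_complete_ge) (auto simp: card_image)
  also have "\<dots> \<le> hom_density (\<lambda>u v. col u \<noteq> col v) T A X ^ (2 ^ card (V - T))"
    using assms(2) \<open>finite T\<close> by (intro power_mono hom_density_antimono hom_density_nonneg) auto
  also have "\<dots> \<le> hom_density (\<lambda>u v. col u \<noteq> col v) (V - T \<union> T) A X"
  proof (rule hom_density_blowup)
    fix b assume "b \<in> V - T"
    then have "col b \<in> col ` T"
      using T(3) by auto
    then show "\<exists>a\<in>T. \<forall>u. col u \<noteq> col b \<longleftrightarrow> col u \<noteq> col a"
      by auto
  qed (use assms \<open>finite T\<close> in \<open>auto simp: symp_def irreflp_def\<close>)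
  also have "V - T \<union> T = V"
    using T(1) by auto
  finally show ?thesis .
qed

section \<open>Simple graphs and shadows\<close>

definition adj :: "'a hgraph \<Rightarrow> 'a \<Rightarrow> 'a \<Rightarrow> bool" where
  "adj F u v \<longleftrightarrow> {u, v} \<in> edges F"

lemma symp_adj: "symp (adj F)"
  by (auto intro: sympI simp: adj_def insert_commute)

lemma simple_graph_edgeE:
  assumes "simple_graph G" "e \<in> edges G"
  obtains u v where "e = {u, v}" "u \<noteq> v" "u \<in> verts G" "v \<in> verts G"
proof -
  have "card e = 2" "e \<subseteq> verts G"
    using assms by (auto simp: k_graph_def hypergraph_def)
  then show ?thesis
    using that by (auto simp: card_2_iff)
qed

lemma simple_graph_edgeD:
  assumes "simple_graph G" "{u, v} \<in> edges G"
  shows "u \<noteq> v" "u \<in> verts G" "v \<in> verts G"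
  using assms by (auto simp: k_graph_def hypergraph_def)

lemma verts_shadow [simp]: "verts (shadow H) = verts H"
  by (simp add: shadow_def)

lemma simple_graph_shadow: "hypergraph H \<Longrightarrow> simple_graph (shadow H)"
  by (fastforce simp: shadow_def k_graph_def hypergraph_def card_2_iff)

lemma edge_density_simple_graph:
  assumes F: "simple_graph F"
  shows "edge_density (adj F) (verts F) = 2 * real (card (edges F)) / (real (card (verts F)))\<^sup>2"
proof -
  define P where "P = {(x, y) \<in> verts F \<times> verts F. adj F x y}"
  define pair where "pair = (\<lambda>(x :: 'a, y). {x, y})"
  have "finite P"
    using F by (auto simp: P_def k_graph_def hypergraph_def
        intro: finite_subset[of _ "verts F \<times> verts F"])
  have image_pair: "pair ` P = edges F"
  proof
    show "edges F \<subseteq> pair ` P"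
    proof
      fix e assume e: "e \<in> edges F"
      then obtain x y where "e = {x, y}" "x \<in> verts F" "y \<in> verts F"
        using simple_graph_edgeE[OF F] by metis
      then show "e \<in> pair ` P"
        using e by (intro image_eqI[of _ _ "(x, y)"]) (auto simp: P_def pair_def adj_def)
    qed
  qed (auto simp: P_def pair_def adj_def)
  have fibre: "card {p \<in> P. pair p = e} = 2" if e: "e \<in> edges F" for e
  proof -
    obtain x y where xy: "e = {x, y}" "x \<noteq> y" "x \<in> verts F" "y \<in> verts F"
      using simple_graph_edgeE[OF F e] .
    then have "{p \<in> P. pair p = e} = {(x, y), (y, x)}"
      using e by (auto simp: P_def pair_def adj_def doubleton_eq_iff insert_commute)
    then show ?thesis
      using \<open>x \<noteq> y\<close> by simp
  qed
  have "card P = (\<Sum>e\<in>edges F. card {p \<in> P. pair p = e})"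
    using sum.image_gen[OF \<open>finite P\<close>, of "\<lambda>_. 1 :: nat" pair] by (simp add: image_pair)
  also have "\<dots> = 2 * card (edges F)"
    using fibre by simp
  finally show ?thesis
    by (simp add: edge_density_def P_def)
qed

section \<open>Berge copies from homomorphisms into the shadow\<close>

lemma card_PiE_coordinate_mem_le:
  assumes "finite V" "finite S" "a \<in> V"
    and small: "\<And>\<phi>. finite (F \<phi>) \<and> card (F \<phi>) \<le> c"
    and indep: "\<And>\<phi> x. F (\<phi>(a := x)) = F \<phi>"
  shows "card {\<phi> \<in> V \<rightarrow>\<^sub>E S. \<phi> a \<in> F \<phi>} \<le> c * card S ^ (card V - 1)"
proof -
  let ?W = "V - {a}"
  let ?D = "SIGMA \<psi> : ?W \<rightarrow>\<^sub>E S. F \<psi>"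
  have fin: "finite (?W \<rightarrow>\<^sub>E S)"
    using assms(1,2) by (intro finite_PiE) auto
  have "{\<phi> \<in> V \<rightarrow>\<^sub>E S. \<phi> a \<in> F \<phi>} \<subseteq> (\<lambda>(\<psi>, x). \<psi>(a := x)) ` ?D"
  proof clarify
    fix \<phi> assume \<phi>: "\<phi> \<in> V \<rightarrow>\<^sub>E S" "\<phi> a \<in> F \<phi>"
    have "\<phi>(a := undefined) \<in> ?W \<rightarrow>\<^sub>E S"
      using \<phi>(1) by (auto simp: PiE_def extensional_def)
    then have "(\<phi>(a := undefined), \<phi> a) \<in> ?D"
      using \<phi>(2) indep by simp
    then show "\<phi> \<in> (\<lambda>(\<psi>, x). \<psi>(a := x)) ` ?D"
      by (rule rev_image_eqI) simp
  qed
  then have "card {\<phi> \<in> V \<rightarrow>\<^sub>E S. \<phi> a \<in> F \<phi>} \<le> card ?D"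
    using fin small by (intro surj_card_le finite_SigmaI) auto
  also have "\<dots> = (\<Sum>\<psi> \<in> ?W \<rightarrow>\<^sub>E S. card (F \<psi>))"
    using fin small by (intro card_SigmaI) auto
  also have "\<dots> \<le> card (?W \<rightarrow>\<^sub>E S) * c"
    using small by (intro sum_bounded_above[where K = c, simplified]) auto
  also have "\<dots> = c * card S ^ (card V - 1)"
    using assms(1,3) by (simp add: card_PiE)
  finally show ?thesis .
qed

lemma card_UN_le_mult:
  assumes "finite I" "\<And>i. i \<in> I \<Longrightarrow> card (B i) \<le> c"
  shows "card (\<Union>i\<in>I. B i) \<le> card I * c"
  using card_UN_le[OF assms(1), of B] sum_bounded_above[of I "\<lambda>i. card (B i)" c] assms(2)
  by fastforce

lemma card_not_inj_on_PiE_le: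
  assumes "finite V" "finite S"
  shows "card {\<phi> \<in> V \<rightarrow>\<^sub>E S. \<not> inj_on \<phi> V} \<le> (card V)\<^sup>2 * card S ^ (card V - 1)"
proof -
  define B where "B = (\<lambda>(a, b). {\<phi> \<in> V \<rightarrow>\<^sub>E S. a \<noteq> b \<and> \<phi> a = \<phi> b})"
  have "card (B (a, b)) \<le> card S ^ (card V - 1)" if "a \<in> V" for a b
  proof (cases "a = b")
    case False
    then show ?thesis
      using card_PiE_coordinate_mem_le[OF assms that, of "\<lambda>\<phi>. {\<phi> b}" 1] by (simp add: B_def)
  qed (simp add: B_def)
  then have "card (\<Union>p\<in>V \<times> V. B p) \<le> card (V \<times> V) * card S ^ (card V - 1)"
    using assms(1) by (intro card_UN_le_mult) auto
  moreover have "{\<phi> \<in> V \<rightarrow>\<^sub>E S. \<not> inj_on \<phi> V} = (\<Union>p\<in>V \<times> V. B p)"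
    by (auto simp: B_def inj_on_def)
  ultimately show ?thesis
    by (simp add: card_cartesian_product power2_eq_square)
qed

lemma card_hitting_PiE_le:
  assumes "finite V" "finite S" "finite E"
    and small: "\<And>Y. finite (h Y) \<and> card (h Y) \<le> k"
  shows "card {\<phi> \<in> V \<rightarrow>\<^sub>E S. \<exists>a\<in>V. \<exists>e\<in>E. a \<notin> e \<and> \<phi> a \<in> h (\<phi> ` e)}
    \<le> k * card V * card E * card S ^ (card V - 1)"
proof -
  define B where "B = (\<lambda>(a, e). {\<phi> \<in> V \<rightarrow>\<^sub>E S. a \<notin> e \<and> \<phi> a \<in> h (\<phi> ` e)})"
  have "card (B (a, e)) \<le> k * card S ^ (card V - 1)" if "a \<in> V" for a e
  proof (cases "a \<in> e")
    case False
    then have "h ((\<phi>(a := x)) ` e) = h (\<phi> ` e)" for \<phi> x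
      by (intro arg_cong[where f = h] image_cong) auto
    with assms(1,2) that small
    have "card {\<phi> \<in> V \<rightarrow>\<^sub>E S. \<phi> a \<in> h (\<phi> ` e)} \<le> k * card S ^ (card V - 1)"
      by (rule card_PiE_coordinate_mem_le)
    with False show ?thesis
      by (simp add: B_def)
  qed (simp add: B_def)
  then have "card (\<Union>p\<in>V \<times> E. B p) \<le> card (V \<times> E) * (k * card S ^ (card V - 1))"
    using assms by (intro card_UN_le_mult) auto
  moreover have "{\<phi> \<in> V \<rightarrow>\<^sub>E S. \<exists>a\<in>V. \<exists>e\<in>E. a \<notin> e \<and> \<phi> a \<in> h (\<phi> ` e)} = (\<Union>p\<in>V \<times> E. B p)"
    by (auto simp: B_def)
  ultimately show ?thesis
    by (simp add: card_cartesian_product mult_ac)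
qed

lemma ex_shadow_cover:
  assumes "k_graph k H"
  obtains h where "\<And>e. e \<in> edges (shadow H) \<Longrightarrow> h e \<in> edges H \<and> e \<subseteq> h e"
    "\<And>e. finite (h e) \<and> card (h e) \<le> k"
proof -
  have "\<exists>x. (e \<in> edges (shadow H) \<longrightarrow> x \<in> edges H \<and> e \<subseteq> x) \<and> finite x \<and> card x \<le> k" for e
  proof (cases "e \<in> edges (shadow H)")
    case True
    then obtain x where x: "x \<in> edges H" "e \<subseteq> x"
      by (auto simp: shadow_def)
    then have "finite x" "card x \<le> k"
      using assms by (auto simp: k_graph_def hypergraph_def intro: finite_subset)
    then show ?thesis
      using x by blast
  next
    case False
    then show ?thesis
      by (intro exI[of _ "{}"]) simp
  qed
  then show ?thesis
    using that by metis
qed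

lemma not_Berge_free_if_generic:
  assumes G: "simple_graph G" and H: "hypergraph H"
    and inj: "inj_on \<phi> (verts G)" and im: "\<phi> ` verts G \<subseteq> verts H"
    and cover: "\<And>e. e \<in> edges G \<Longrightarrow> f e \<in> edges H \<and> \<phi> ` e \<subseteq> f e"
    and generic: "\<And>a e. a \<in> verts G \<Longrightarrow> e \<in> edges G \<Longrightarrow> a \<notin> e \<Longrightarrow> \<phi> a \<notin> f e"
  shows "\<not> Berge_free G H"
proof -
  have "inj_on f (edges G)"
  proof (rule inj_onI, rule ccontr)
    fix e e' assume e: "e \<in> edges G" "e' \<in> edges G" "f e = f e'" "e \<noteq> e'"
    then have "\<not> e' \<subseteq> e"
      using G by (elim simple_graph_edgeE[OF G]) auto
    then obtain a where a: "a \<in> e'" "a \<notin> e"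
      by auto
    moreover have "a \<in> verts G"
      using a e G by (auto simp: k_graph_def hypergraph_def)
    ultimately show False
      using generic[of a e] cover[of e'] e by auto
  qed
  then have "bij_betw f (edges G) (f ` edges G)"
    by (rule inj_on_imp_bij_betw)
  moreover have "{\<phi> u, \<phi> v} \<subseteq> f {u, v}" if "{u, v} \<in> edges G" for u v
    using cover[OF that] by auto
  ultimately have "is_Berge G (verts H, f ` edges G)"
    unfolding is_Berge_def using inj im by auto
  moreover have "subhypergraph (verts H, f ` edges G) H"
    using H cover by (auto simp: subhypergraph_def hypergraph_def)
  ultimately show ?thesis
    by (auto simp: Berge_free_def)
qed

lemma degenerate_hom_if_Berge_free:
  assumes G: "simple_graph G" and "hypergraph H" "Berge_free G H"
    and \<phi>: "\<phi> \<in> homs (adj G) (verts G) (adj (shadow H)) (verts H)"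
    and cover: "\<And>e. e \<in> edges (shadow H) \<Longrightarrow> h e \<in> edges H \<and> e \<subseteq> h e"
  shows "\<not> inj_on \<phi> (verts G) \<or> (\<exists>a\<in>verts G. \<exists>e\<in>edges G. a \<notin> e \<and> \<phi> a \<in> h (\<phi> ` e))"
proof (rule ccontr)
  assume nondegenerate: "\<not> ?thesis"
  have "\<phi> ` e \<in> edges (shadow H)" if e: "e \<in> edges G" for e
  proof -
    obtain u v where "e = {u, v}" "u \<in> verts G" "v \<in> verts G"
      using simple_graph_edgeE[OF G e] by metis
    then show ?thesis
      using \<phi> e by (simp add: homs_def adj_def)
  qed
  then have "\<not> Berge_free G H"
    using \<phi> cover nondegenerate \<open>hypergraph H\<close>
    by (intro not_Berge_free_if_generic[OF G, where \<phi> = \<phi> and f = "\<lambda>e. h (\<phi> ` e)"])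
      (auto simp: homs_def)
  then show False
    using \<open>Berge_free G H\<close> by blast
qed

definition degenerate_const :: "nat \<Rightarrow> 'a hgraph \<Rightarrow> nat" where
  "degenerate_const k G = (card (verts G))\<^sup>2 + k * card (verts G) * card (edges G)"

lemma card_homs_shadow_le:
  assumes G: "simple_graph G" and H: "k_graph k H" and "Berge_free G H"
  shows "card (homs (adj G) (verts G) (adj (shadow H)) (verts H))
    \<le> degenerate_const k G * card (verts H) ^ (card (verts G) - 1)"
proof -
  define V X where "V = verts G" and "X = verts H"
  have fin: "finite V" "finite X" "finite (edges G)"
    using G H finite_subset[of "edges G" "Pow (verts G)"]
    by (auto simp: V_def X_def k_graph_def hypergraph_def)
  obtain h where cover: "\<And>e. e \<in> edges (shadow H) \<Longrightarrow> h e \<in> edges H \<and> e \<subseteq> h e"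
    and small: "\<And>e. finite (h e) \<and> card (h e) \<le> k"
    using ex_shadow_cover[OF H] by metis
  define noninj where "noninj = {\<phi> \<in> V \<rightarrow>\<^sub>E X. \<not> inj_on \<phi> V}"
  define hitting where
    "hitting = {\<phi> \<in> V \<rightarrow>\<^sub>E X. \<exists>a\<in>V. \<exists>e\<in>edges G. a \<notin> e \<and> \<phi> a \<in> h (\<phi> ` e)}"
  have "hypergraph H"
    using H by (simp add: k_graph_def)
  then have "homs (adj G) V (adj (shadow H)) X \<subseteq> noninj \<union> hitting"
    using degenerate_hom_if_Berge_free[OF G _ \<open>Berge_free G H\<close> _ cover]
    by (auto simp: noninj_def hitting_def homs_def V_def X_def)
  then have "card (homs (adj G) V (adj (shadow H)) X) \<le> card (noninj \<union> hitting)"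
    using fin by (intro card_mono) (auto simp: noninj_def hitting_def finite_PiE)
  also have "\<dots> \<le> card noninj + card hitting"
    by (rule card_Un_le)
  also have "\<dots> \<le> (card V)\<^sup>2 * card X ^ (card V - 1)
      + k * card V * card (edges G) * card X ^ (card V - 1)"
    unfolding noninj_def hitting_def
    using fin small by (intro add_mono card_not_inj_on_PiE_le card_hitting_PiE_le)
  finally show ?thesis
    by (simp add: V_def X_def degenerate_const_def add_mult_distrib)
qed

lemma hom_density_shadow_le:
  assumes "simple_graph G" "k_graph k H" "Berge_free G H"
  shows "hom_density (adj G) (verts G) (adj (shadow H)) (verts H)
    \<le> real (degenerate_const k G) / real (card (verts H))"
proof -
  define m n where "m = card (verts G)" and "n = card (verts H)"
  have "hom_density (adj G) (verts G) (adj (shadow H)) (verts H)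
      \<le> real (degenerate_const k G * n ^ (m - 1)) / real n ^ m"
    unfolding hom_density_def m_def n_def
    by (intro divide_right_mono of_nat_mono card_homs_shadow_le assms) simp
  also have "\<dots> = real (degenerate_const k G) / real n"
    by (cases m) (auto simp: degenerate_const_def simp flip: m_def)
  finally show ?thesis
    by (simp add: n_def)
qed

lemma card_verts_le_if_edge_density_shadow_ge:
  fixes \<gamma> :: real
  assumes G: "simple_graph G" and H: "k_graph k H" "Berge_free G H"
    and col: "proper_coloring G (Suc r) col"
    and dense: "1 - \<gamma> \<le> edge_density (adj (shadow H)) (verts H)" and "real r * \<gamma> \<le> 1"
  shows "(1 - real r * \<gamma>) ^ (card (verts G) * 2 ^ card (verts G)) * real (card (verts H))
    \<le> real (degenerate_const k G)" (is "?\<delta> * _ \<le> ?C")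
proof (cases "verts H = {}")
  case False
  have fin: "finite (verts G)" "finite (verts H)"
    using G H(1) by (simp_all add: k_graph_def hypergraph_def)
  have "card (col ` verts G) \<le> Suc r"
    using card_mono[of "{..<Suc r}" "col ` verts G"] col by (simp add: proper_coloring_def)
  then have "?\<delta> \<le> hom_density (\<lambda>u v. col u \<noteq> col v) (verts G) (adj (shadow H)) (verts H)"
    using fin False dense \<open>real r * \<gamma> \<le> 1\<close> by (intro hom_density_multipartite_ge symp_adj) auto
  also have "\<dots> \<le> hom_density (adj G) (verts G) (adj (shadow H)) (verts H)"
    using fin col by (intro hom_density_antimono) (auto simp: adj_def proper_coloring_def)
  also have "\<dots> \<le> ?C / real (card (verts H))"
    using hom_density_shadow_le[OF G H] .
  finally show ?thesis
    using fin False by (simp add: pos_le_divide_eq card_gt_0_iff)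
qed simp

section \<open>Proper colourings\<close>

lemma ex_proper_coloring_chromatic_number:
  assumes "simple_graph G"
  obtains col where "proper_coloring G (chromatic_number G) col"
proof -
  have "finite (verts G)"
    using assms by (simp add: k_graph_def hypergraph_def)
  then obtain f :: "'a \<Rightarrow> nat" and n where f: "f ` verts G = {i. i < n}" "inj_on f (verts G)"
    using finite_imp_inj_to_nat_seg by metis
  have "f u \<noteq> f v" if "{u, v} \<in> edges G" for u v
    using simple_graph_edgeD[OF assms that] f(2) by (auto dest: inj_onD)
  then have "proper_coloring G n f"
    using f(1) by (auto simp: proper_coloring_def)
  then have "\<exists>c col. proper_coloring G c col"
    by blast
  then have "\<exists>col. proper_coloring G (chromatic_number G) col"
    unfolding chromatic_number_def by (rule LeastI_ex)
  then show ?thesis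
    using that by blast
qed

lemma chromatic_number_le: "proper_coloring G c col \<Longrightarrow> chromatic_number G \<le> c"
  unfolding chromatic_number_def by (rule Least_le) blast

lemma chromatic_number_le_1_if_no_edges:
  assumes "edges G = {}"
  shows "chromatic_number G \<le> 1"
proof (rule chromatic_number_le)
  show "proper_coloring G 1 (\<lambda>_. 0)"
    using assms by (auto simp: proper_coloring_def)
qed

section \<open>Rainbow hypergraphs\<close>

definition rainbow_hgraph :: "nat \<Rightarrow> ('a \<Rightarrow> 'c) \<Rightarrow> 'a set \<Rightarrow> 'a hgraph" where
  "rainbow_hgraph k c X = (X, {h. h \<subseteq> X \<and> card h = k \<and> inj_on c h})"

lemma verts_rainbow_hgraph [simp]: "verts (rainbow_hgraph k c X) = X"
  by (simp add: rainbow_hgraph_def)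

lemma k_graph_rainbow_hgraph: "finite X \<Longrightarrow> k_graph k (rainbow_hgraph k c X)"
  by (auto simp: rainbow_hgraph_def k_graph_def hypergraph_def)

lemma Berge_free_rainbow_hgraph:
  fixes c :: "'b \<Rightarrow> nat"
  assumes G: "simple_graph G" and c: "c ` X \<subseteq> {..<r}" and "r < chromatic_number G"
  shows "Berge_free G (rainbow_hgraph k c X)"
  unfolding Berge_free_def
proof
  assume "\<exists>H'. subhypergraph H' (rainbow_hgraph k c X) \<and> is_Berge G H'"
  then obtain H' i f where H': "verts H' \<subseteq> X" "edges H' \<subseteq> edges (rainbow_hgraph k c X)"
    and i: "inj_on i (verts G)" "i ` verts G \<subseteq> verts H'"
    and f: "bij_betw f (edges G) (edges H')" "\<And>u v. {u, v} \<in> edges G \<Longrightarrow> {i u, i v} \<subseteq> f {u, v}"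
    by (auto simp: subhypergraph_def is_Berge_def)
  have "c (i u) \<noteq> c (i v)" if uv: "{u, v} \<in> edges G" for u v
  proof -
    have "i u \<noteq> i v"
      using simple_graph_edgeD[OF G uv] i(1) by (auto dest: inj_onD)
    moreover have "f {u, v} \<in> edges (rainbow_hgraph k c X)"
      using f(1) uv H'(2) by (auto simp: bij_betw_def)
    then have "inj_on c (f {u, v})"
      by (simp add: rainbow_hgraph_def)
    ultimately show ?thesis
      using f(2)[OF uv] by (auto dest: inj_onD)
  qed
  then have "proper_coloring G r (c \<circ> i)"
    using c i(2) H'(1) by (auto simp: proper_coloring_def image_subset_iff subset_iff)
  then show False
    using chromatic_number_le \<open>r < chromatic_number G\<close> by fastforce
qed

lemma shadow_rainbow_hgraph:
  assumes "2 \<le> k" "k \<le> card (c ` X)" "finite X" "u \<in> X" "v \<in> X" "c u \<noteq> c v"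
  shows "{u, v} \<in> edges (shadow (rainbow_hgraph k c X))"
proof -
  have "card (c ` X - {c u, c v}) = card (c ` X) - 2"
    using assms by (subst card_Diff_subset) auto
  then obtain C where C: "C \<subseteq> c ` X - {c u, c v}" "card C = k - 2"
    using assms(2) by (metis obtain_subset_with_card_n diff_le_mono)
  then obtain D where D: "D \<subseteq> X" "inj_on c D" "C = c ` D"
    by (metis Diff_subset subset_image_inj subset_trans)
  let ?h = "insert u (insert v D)"
  have "finite D"
    using D(1) \<open>finite X\<close> by (rule finite_subset)
  moreover have "card D = k - 2"
    using C(2) D by (simp add: card_image)
  moreover have "u \<notin> D" "v \<notin> D" "u \<noteq> v"
    using C(1) D(3) assms(6) by auto
  ultimately have "card ?h = k"
    using assms(1) by simp
  moreover have "inj_on c ?h"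
    using C(1) D assms(6) by auto
  ultimately have "?h \<in> edges (rainbow_hgraph k c X)"
    using D(1) assms by (simp add: rainbow_hgraph_def)
  then show ?thesis
    using \<open>u \<noteq> v\<close> unfolding shadow_def snd_conv by blast
qed

lemma edge_density_shadow_rainbow_hgraph_ge:
  assumes "2 \<le> k" "k \<le> card (c ` X)" "finite X"
    and fibre: "\<And>u. u \<in> X \<Longrightarrow> card {v \<in> X. c v = c u} \<le> q"
  shows "1 - real q / real (card X) \<le> edge_density (adj (shadow (rainbow_hgraph k c X))) X"
proof -
  define same where "same = (SIGMA u : X. {v \<in> X. c v = c u})"
  define cross where "cross = {(u, v) \<in> X \<times> X. adj (shadow (rainbow_hgraph k c X)) u v}"
  define n where "n = card X"
  have "n > 0"
    using assms(1-3) by (auto simp: n_def card_gt_0_iff)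
  have "card same = (\<Sum>u\<in>X. card {v \<in> X. c v = c u})"
    using \<open>finite X\<close> by (simp add: same_def card_SigmaI)
  also have "\<dots> \<le> n * q"
    using sum_bounded_above[of X _ q] fibre by (simp add: n_def)
  finally have card_same: "card same \<le> n * q" .
  have "X \<times> X \<subseteq> same \<union> cross"
    using shadow_rainbow_hgraph[OF assms(1-3)] by (auto simp: same_def cross_def adj_def)
  then have "card (X \<times> X) \<le> card (same \<union> cross)"
    using \<open>finite X\<close>
    by (intro card_mono) (auto simp: same_def cross_def intro: finite_subset[of _ "X \<times> X"])
  also have "\<dots> \<le> card same + card cross"
    by (rule card_Un_le)
  finally have "n * n \<le> n * q + card cross"
    using card_same by (simp add: card_cartesian_product n_def)
  then have "real (n * n) \<le> real (n * q + card cross)"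
    by (simp only: of_nat_le_iff)
  then have "(real n * real n - real n * real q) / (real n)\<^sup>2 \<le> real (card cross) / (real n)\<^sup>2"
    by (intro divide_right_mono) auto
  then show ?thesis
    using \<open>n > 0\<close>
    by (simp add: edge_density_def cross_def n_def diff_divide_distrib power2_eq_square)
qed

lemma card_residue_class_le: "card {v \<in> {..<n :: nat}. v mod r = c} \<le> n div r + 1"
proof -
  have "inj_on (\<lambda>v. v div r) {v \<in> {..<n}. v mod r = c}"
    by (intro inj_onI) (metis (mono_tags, lifting) div_mult_mod_eq mem_Collect_eq)
  moreover have "(\<lambda>v. v div r) ` {v \<in> {..<n}. v mod r = c} \<subseteq> {..n div r}"
    by (auto intro: div_le_mono)
  ultimately show ?thesis
    using card_inj_on_le[of _ _ "{..n div r}"] by fastforce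
qed

abbreviation residue_hgraph :: "nat \<Rightarrow> nat \<Rightarrow> nat \<Rightarrow> nat hgraph" where
  "residue_hgraph k r n \<equiv> rainbow_hgraph k (\<lambda>v. v mod r) {..<n}"

lemma edge_density_shadow_residue_hgraph_ge:
  assumes "2 \<le> k" "k \<le> r" "r \<le> n"
  shows "1 - 1 / real r - 1 / real n
    \<le> edge_density (adj (shadow (residue_hgraph k r n))) {..<n}"
proof -
  have "(\<lambda>v. v mod r) ` {..<r} \<subseteq> (\<lambda>v. v mod r) ` {..<n}"
    using \<open>r \<le> n\<close> by (intro image_mono) auto
  then have "card {..<r} \<le> card ((\<lambda>v. v mod r) ` {..<n})"
    by (intro card_mono) auto
  then have density: "1 - real (n div r + 1) / real n
      \<le> edge_density (adj (shadow (residue_hgraph k r n))) {..<n}"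
    using edge_density_shadow_rainbow_hgraph_ge[of k "\<lambda>v. v mod r" "{..<n}" "n div r + 1"]
      assms card_residue_class_le by simp
  have "real (n div r + 1) / real n \<le> (real n / real r + 1) / real n"
    using of_nat_div_le_of_nat[of n r] by (intro divide_right_mono) auto
  also have "\<dots> = 1 / real r + 1 / real n"
    using assms by (simp add: add_divide_distrib)
  finally show ?thesis
    using density by linarith
qed

section \<open>The cover Turan density\<close>

definition cover_values :: "nat \<Rightarrow> nat \<Rightarrow> 'a hgraph \<Rightarrow> nat set" where
  "cover_values k n G = {card (edges (shadow H)) | H :: nat hgraph.
     k_graph k H \<and> card (verts H) = n \<and> Berge_free G H}"

lemma cover_ex_eq_Max: "cover_ex k n G = Max (cover_values k n G)"
  by (simp add: cover_ex_def cover_values_def)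

lemma finite_cover_values: "finite (cover_values k n G)"
proof (rule finite_subset)
  show "cover_values k n G \<subseteq> {..2 ^ n}"
  proof (clarsimp simp: cover_values_def)
    fix X :: "nat set" and E
    assume "k_graph k (X, E)"
    then have "edges (shadow (X, E)) \<subseteq> Pow X" "finite X"
      by (auto simp: shadow_def k_graph_def hypergraph_def)
    then show "card (edges (shadow (X, E))) \<le> 2 ^ card X"
      by (metis card_Pow card_mono finite_Pow_iff)
  qed
qed simp

lemma cover_ex_ge:
  fixes H :: "nat hgraph"
  assumes "k_graph k H" "card (verts H) = n" "Berge_free G H"
  shows "card (edges (shadow H)) \<le> cover_ex k n G"
  unfolding cover_ex_eq_Max
  by (rule Max_ge[OF finite_cover_values]) (use assms in \<open>unfold cover_values_def, blast\<close>)

lemma cover_ex_attained: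
  assumes "edges G \<noteq> {}"
  obtains H :: "nat hgraph" where "k_graph k H" "card (verts H) = n" "Berge_free G H"
    "cover_ex k n G = card (edges (shadow H))"
proof -
  let ?H = "({..<n}, {}) :: nat hgraph"
  have "Berge_free G ?H"
    using assms by (auto simp: Berge_free_def subhypergraph_def is_Berge_def bij_betw_def)
  moreover have "k_graph k ?H" "card (verts ?H) = n"
    by (auto simp: k_graph_def hypergraph_def)
  ultimately have "cover_values k n G \<noteq> {}"
    unfolding cover_values_def by blast
  then have "cover_ex k n G \<in> cover_values k n G"
    unfolding cover_ex_eq_Max by (rule Max_in[OF finite_cover_values])
  then show ?thesis
    using that unfolding cover_values_def by blast
qed

lemma real_choose_two: "real (n choose 2) = real n * (real n - 1) / 2"
  by (induction n) (auto simp: numeral_2_eq_2 field_simps)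

lemma card_edges_shadow_div_choose_two:
  assumes "hypergraph H" "card (verts H) = n"
  shows "real (card (edges (shadow H))) / real (n choose 2)
    = edge_density (adj (shadow H)) (verts H) * (real n / (real n - 1))"
proof -
  have "edge_density (adj (shadow H)) (verts H) = 2 * real (card (edges (shadow H))) / (real n)\<^sup>2"
    using edge_density_simple_graph[OF simple_graph_shadow[OF assms(1)]] assms(2) by simp
  then show ?thesis
    by (simp add: real_choose_two power2_eq_square)
qed

lemma tendsto_mult_n_over_pred_n:
  fixes f :: "nat \<Rightarrow> real"
  assumes "f \<longlonglongrightarrow> L"
  shows "(\<lambda>n. f n * (real n / (real n - 1))) \<longlonglongrightarrow> L"
proof -
  have "(\<lambda>n. real n / (real n - 1)) \<longlonglongrightarrow> 1"
  proof (rule LIMSEQ_imp_Suc)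
    show "(\<lambda>n. real (Suc n) / (real (Suc n) - 1)) \<longlonglongrightarrow> 1"
      using LIMSEQ_Suc_n_over_n[where 'a = real] by simp
  qed
  from tendsto_mult[OF assms this] show ?thesis
    by simp
qed

lemma cover_turan_density_le_if_edge_density_le:
  assumes "edges G \<noteq> {}"
    and "\<forall>\<^sub>F n in sequentially. \<forall>H :: nat hgraph. k_graph k H \<and> card (verts H) = n \<and> Berge_free G H
      \<longrightarrow> edge_density (adj (shadow H)) (verts H) \<le> d"
  shows "cover_turan_density k G \<le> ereal d"
proof -
  have "\<forall>\<^sub>F n in sequentially. ereal (real (cover_ex k n G) / real (n choose 2))
      \<le> ereal (d * (real n / (real n - 1)))"
    using assms(2) eventually_gt_at_top[of 1]
  proof eventually_elim
    case (elim n)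
    obtain H :: "nat hgraph" where H: "k_graph k H" "card (verts H) = n" "Berge_free G H"
      "cover_ex k n G = card (edges (shadow H))"
      by (rule cover_ex_attained[OF assms(1)])
    then have "real (cover_ex k n G) / real (n choose 2)
        = edge_density (adj (shadow H)) (verts H) * (real n / (real n - 1))"
      using card_edges_shadow_div_choose_two[of H n] by (simp only: k_graph_def)
    also have "\<dots> \<le> d * (real n / (real n - 1))"
      using elim(1)[rule_format, of H] elim(2) H by (intro mult_right_mono) auto
    finally show ?case by simp
  qed
  then have "cover_turan_density k G \<le> limsup (\<lambda>n. ereal (d * (real n / (real n - 1))))"
    unfolding cover_turan_density_def by (rule Limsup_mono)
  also have "\<dots> = ereal d"
    by (intro lim_imp_Limsup tendsto_ereal tendsto_mult_n_over_pred_n tendsto_const) simp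
  finally show ?thesis .
qed

lemma cover_turan_density_ge_if_edge_density_ge:
  fixes H :: "nat \<Rightarrow> nat hgraph" and d :: "nat \<Rightarrow> real"
  assumes H: "\<And>n. k_graph k (H n)" "\<And>n. card (verts (H n)) = n" "\<And>n. Berge_free G (H n)"
    and dense: "\<forall>\<^sub>F n in sequentially. d n \<le> edge_density (adj (shadow (H n))) (verts (H n))"
    and "d \<longlonglongrightarrow> L"
  shows "ereal L \<le> cover_turan_density k G"
proof -
  have "\<forall>\<^sub>F n in sequentially. ereal (d n * (real n / (real n - 1)))
      \<le> ereal (real (cover_ex k n G) / real (n choose 2))"
    using dense eventually_gt_at_top[of 1]
  proof eventually_elim
    case (elim n)
    have "d n * (real n / (real n - 1))
        \<le> edge_density (adj (shadow (H n))) (verts (H n)) * (real n / (real n - 1))"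
      using elim by (intro mult_right_mono) auto
    also have "\<dots> = real (card (edges (shadow (H n)))) / real (n choose 2)"
      using H(1,2)[of n] by (simp add: card_edges_shadow_div_choose_two k_graph_def)
    also have "\<dots> \<le> real (cover_ex k n G) / real (n choose 2)"
      using H[of n] by (intro divide_right_mono of_nat_mono cover_ex_ge) auto
    finally show ?case by simp
  qed
  then have "limsup (\<lambda>n. ereal (d n * (real n / (real n - 1)))) \<le> cover_turan_density k G"
    unfolding cover_turan_density_def by (rule Limsup_mono)
  moreover have "limsup (\<lambda>n. ereal (d n * (real n / (real n - 1)))) = ereal L"
    by (intro lim_imp_Limsup tendsto_ereal tendsto_mult_n_over_pred_n assms(5)) simp
  ultimately show ?thesis by simp
qed

lemma cover_turan_density_le:
  assumes G: "simple_graph G" "edges G \<noteq> {}" and col: "proper_coloring G (Suc r) col" and "1 \<le> r"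
  shows "cover_turan_density k G \<le> ereal (1 - 1 / real r)"
proof (rule ereal_le_epsilon2)
  fix \<epsilon> :: real assume "\<epsilon> > 0"
  define \<gamma> where "\<gamma> = 1 / real r - \<epsilon>"
  define \<delta> where "\<delta> = (1 - real r * \<gamma>) ^ (card (verts G) * 2 ^ card (verts G))"
  define C where "C = real (degenerate_const k G)"
  have "real r * \<gamma> < 1"
    using \<open>1 \<le> r\<close> \<open>\<epsilon> > 0\<close> by (simp add: \<gamma>_def field_simps)
  then have "\<delta> > 0"
    by (simp add: \<delta>_def)
  have "\<forall>\<^sub>F n in sequentially. C / \<delta> < real n"
    using filterlim_real_sequentially by (simp add: filterlim_at_top_dense)
  then have "\<forall>\<^sub>F n in sequentially. \<forall>H :: nat hgraph.
      k_graph k H \<and> card (verts H) = n \<and> Berge_free G H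
      \<longrightarrow> edge_density (adj (shadow H)) (verts H) \<le> 1 - \<gamma>"
  proof (rule eventually_mono, intro allI impI leI notI)
    fix n and H :: "nat hgraph"
    assume "C / \<delta> < real n" and "k_graph k H \<and> card (verts H) = n \<and> Berge_free G H"
      and "1 - \<gamma> < edge_density (adj (shadow H)) (verts H)"
    then have "\<delta> * real n \<le> C"
      unfolding \<delta>_def C_def
      using card_verts_le_if_edge_density_shadow_ge[OF G(1) _ _ col, of k H \<gamma>] \<open>real r * \<gamma> < 1\<close>
      by auto
    then show False
      using \<open>C / \<delta> < real n\<close> \<open>\<delta> > 0\<close> by (simp add: field_simps)
  qed
  then have "cover_turan_density k G \<le> ereal (1 - \<gamma>)"
    by (rule cover_turan_density_le_if_edge_density_le[OF G(2)])
  then show "cover_turan_density k G \<le> ereal (1 - 1 / real r) + ereal \<epsilon>"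
    by (simp add: \<gamma>_def algebra_simps)
qed

lemma cover_turan_density_ge:
  assumes G: "simple_graph G" and "r < chromatic_number G" "2 \<le> k" "k \<le> r"
  shows "ereal (1 - 1 / real r) \<le> cover_turan_density k G"
proof (rule cover_turan_density_ge_if_edge_density_ge)
  show "k_graph k (residue_hgraph k r n)" "card (verts (residue_hgraph k r n)) = n" for n
    by (simp_all add: k_graph_rainbow_hgraph)
  show "Berge_free G (residue_hgraph k r n)" for n
    using assms by (intro Berge_free_rainbow_hgraph[where r = r]) auto
  show "\<forall>\<^sub>F n in sequentially. 1 - 1 / real r - 1 / real n
      \<le> edge_density (adj (shadow (residue_hgraph k r n))) (verts (residue_hgraph k r n))"
    using eventually_ge_at_top[of r]
    by eventually_elim (use assms edge_density_shadow_residue_hgraph_ge in simp)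
  show "(\<lambda>n. 1 - 1 / real r - 1 / real n) \<longlonglongrightarrow> 1 - 1 / real r"
    using tendsto_diff[OF tendsto_const[of "1 - 1 / real r"] lim_1_over_n] by simp
qed

theorem theorem2:
  fixes k :: nat and G :: "'a hgraph"
  assumes "k \<ge> 2"
    and "simple_graph G"
    and "chromatic_number G \<ge> k + 1"
  shows "cover_turan_density k G = ereal (1 - 1 / (real (chromatic_number G) - 1))"
proof -
  define r where "r = chromatic_number G - 1"
  have r: "chromatic_number G = Suc r" "k \<le> r" "1 \<le> r"
    using assms(1,3) by (auto simp: r_def)
  obtain col where "proper_coloring G (Suc r) col"
    using ex_proper_coloring_chromatic_number[OF assms(2)] r(1) by metis
  moreover have "edges G \<noteq> {}"
    using chromatic_number_le_1_if_no_edges[of G] r by auto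
  ultimately have "cover_turan_density k G \<le> ereal (1 - 1 / real r)"
    using cover_turan_density_le assms(2) r(3) by blast
  moreover have "ereal (1 - 1 / real r) \<le> cover_turan_density k G"
    using cover_turan_density_ge[of G r k] assms(1,2) r by simp
  ultimately show ?thesis
    using r(1) by simp
qed

end
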